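(* Let $(V,d)$ be a finite metric space, $k$ a positive integer and $R>0$. Let $G_R$ be the graph on $V$ with edge set $\{uv: d(u,v)\le R\}$, and for each connected component $C$ of $G_R$ let $T_C$ be a minimum-weight spanning tree of $C$ in $G_R$. Call $C$ small if $w(T_C)<2R$ and large otherwise. Assume $\sum_{C}\big\lfloor \frac{w(T_C)+2R}{2R}\big\rfloor = k$, the sum being over all components $C$ of $G_R$. Let $\mathcal T$ be the collection consisting of $T_C$ for every small $C$, together with, for every large $C$, a family of edge-disjoint subtrees of $T_C$ whose union is $T_C$, each of weight at most $4R$ and all but at most one of them of weight at least $2R$. Suppose $\mathcal T=\{T_1,\dots,T_k\}$ consists of exactly $k$ trees. Then for every $p\in[1,\infty)$ and every tree cover $\{\hat T_1,\dots,\hat T_k\}$ of $(V,d)$ of size $k$, $$\Big(\sum_{i=1}^k w(T_i)^p\Big)^{1/p}\le 24\Big(\sum_{i=1}^k w(\hat T_i)^p\Big)^{1/p}.$$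
   Context: A finite metric space $(V,d)$ is identified with the complete graph on $V$ with edge weights $d$. A tree is a tree in this complete graph on some subset of $V$ (a single vertex is allowed); its weight is $w(T)=\sum_{uv\in E(T)} d(u,v)$. A tree cover of size $k$ is a collection of $k$ trees whose vertex sets together cover $V$; the trees need not be disjoint. *)

theory Defs
  imports "HOL-Analysis.Analysis"
begin

record 'a ugraph =
  gverts :: "'a set"
  gedges :: "'a set set"

text \<open>Finite simple undirected graphs; an edge is a two-element set of vertices.\<close>

definition simple_graph :: "'a ugraph \<Rightarrow> bool" where
  "simple_graph G \<longleftrightarrow>
     finite (gverts G) \<and>
     (\<forall>e\<in>gedges G. \<exists>u\<in>gverts G. \<exists>v\<in>gverts G. u \<noteq> v \<and> e = {u, v})"

definition subgraph :: "'a ugraph \<Rightarrow> 'a ugraph \<Rightarrow> bool" where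
  "subgraph H G \<longleftrightarrow>
     simple_graph H \<and> simple_graph G \<and> gverts H \<subseteq> gverts G \<and> gedges H \<subseteq> gedges G"

definition induced :: "'a ugraph \<Rightarrow> 'a set \<Rightarrow> 'a ugraph" where
  "induced G C = \<lparr>gverts = C, gedges = {e \<in> gedges G. e \<subseteq> C}\<rparr>"

definition reachable :: "'a ugraph \<Rightarrow> 'a \<Rightarrow> 'a \<Rightarrow> bool" where
  "reachable G = (\<lambda>u v. {u, v} \<in> gedges G)\<^sup>*\<^sup>*"

definition graph_connected :: "'a ugraph \<Rightarrow> bool" where
  "graph_connected G \<longleftrightarrow>
     gverts G \<noteq> {} \<and> (\<forall>u\<in>gverts G. \<forall>v\<in>gverts G. reachable G u v)"

definition graph_components :: "'a ugraph \<Rightarrow> 'a set set" where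
  "graph_components G = {{v \<in> gverts G. reachable G u v} | u. u \<in> gverts G}"

definition is_cycle :: "'a ugraph \<Rightarrow> 'a list \<Rightarrow> bool" where
  "is_cycle G xs \<longleftrightarrow>
     length xs \<ge> 3 \<and> distinct xs \<and>
     (\<forall>i<length xs. {xs ! i, xs ! (Suc i mod length xs)} \<in> gedges G)"

definition is_tree :: "'a ugraph \<Rightarrow> bool" where
  "is_tree T \<longleftrightarrow> simple_graph T \<and> graph_connected T \<and> (\<nexists>xs. is_cycle T xs)"

text \<open>The description below is unambiguous because distances are symmetric.\<close>

definition edge_length :: "('a \<Rightarrow> 'a \<Rightarrow> real) \<Rightarrow> 'a set \<Rightarrow> real" where
  "edge_length d e = (THE r. \<exists>u v. e = {u, v} \<and> r = d u v)"

lemma edge_length_pair: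
  assumes "\<And>x y. d x y = d y x"
  shows "edge_length d {u, v} = d u v"
  unfolding edge_length_def
  by (rule the_equality) (use assms in \<open>auto simp: doubleton_eq_iff\<close>)

definition weight :: "('a \<Rightarrow> 'a \<Rightarrow> real) \<Rightarrow> 'a ugraph \<Rightarrow> real" where
  "weight d G = (\<Sum>e\<in>gedges G. edge_length d e)"

definition spanning_tree :: "'a ugraph \<Rightarrow> 'a ugraph \<Rightarrow> bool" where
  "spanning_tree T G \<longleftrightarrow> is_tree T \<and> subgraph T G \<and> gverts T = gverts G"

definition min_spanning_tree :: "('a \<Rightarrow> 'a \<Rightarrow> real) \<Rightarrow> 'a ugraph \<Rightarrow> 'a ugraph \<Rightarrow> bool" where
  "min_spanning_tree d T G \<longleftrightarrow>
     spanning_tree T G \<and> (\<forall>T'. spanning_tree T' G \<longrightarrow> weight d T \<le> weight d T')"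

definition complete_graph :: "'a set \<Rightarrow> 'a ugraph" where
  "complete_graph V = \<lparr>gverts = V, gedges = {{u, v} | u v. u \<in> V \<and> v \<in> V \<and> u \<noteq> v}\<rparr>"

definition threshold_graph :: "'a set \<Rightarrow> ('a \<Rightarrow> 'a \<Rightarrow> real) \<Rightarrow> real \<Rightarrow> 'a ugraph" where
  "threshold_graph V d R =
     \<lparr>gverts = V, gedges = {{u, v} | u v. u \<in> V \<and> v \<in> V \<and> u \<noteq> v \<and> d u v \<le> R}\<rparr>"

text \<open>A tree cover is an indexed family, so repetitions are allowed.\<close>

definition tree_cover :: "'a set \<Rightarrow> nat \<Rightarrow> (nat \<Rightarrow> 'a ugraph) \<Rightarrow> bool" where
  "tree_cover V k T \<longleftrightarrow>
     (\<forall>i\<in>{1..k}. is_tree (T i) \<and> subgraph (T i) (complete_graph V)) \<and>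
     (\<Union>i\<in>{1..k}. gverts (T i)) = V"

text \<open>
  Edge-disjoint subtrees of \<open>T\<close> with union \<open>T\<close>, as required of a large component.
  Since \<open>R > 0\<close>, a tree without edges has weight below \<open>2 * R\<close>, so at most one member
  is edgeless and a family of such subtrees has no repetitions; a set loses nothing.
\<close>

definition tree_decomposition ::
    "('a \<Rightarrow> 'a \<Rightarrow> real) \<Rightarrow> real \<Rightarrow> 'a ugraph \<Rightarrow> 'a ugraph set \<Rightarrow> bool" where
  "tree_decomposition d R T F \<longleftrightarrow>
     (\<forall>S\<in>F. is_tree S \<and> subgraph S T) \<and>
     (\<forall>S\<in>F. \<forall>S'\<in>F. S \<noteq> S' \<longrightarrow> gedges S \<inter> gedges S' = {}) \<and>
     (\<Union>S\<in>F. gverts S) = gverts T \<and> (\<Union>S\<in>F. gedges S) = gedges T \<and>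
     (\<forall>S\<in>F. weight d S \<le> 4 * R) \<and>
     (\<exists>S0. \<forall>S\<in>F. S \<noteq> S0 \<longrightarrow> weight d S \<ge> 2 * R)"

end

theory Submission
  imports Defs
begin

text \<open>
  Cut each tree of the competing cover at its edges longer than \<open>R\<close>: a tree with \<open>n\<close> such edges
  falls into at most \<open>n + 1\<close> pieces, each inside one component of \<open>G\<^sub>R\<close>. Joining the pieces inside a
  component \<open>C\<close> by edges of \<open>G\<^sub>R\<close> bounds \<open>w(T\<^sub>C)\<close> by the weight of the pieces plus \<open>R\<close> for all but one
  of them. Call a tree heavy if its weight is at least \<open>R / 4\<close>; a light tree is a single piece.
  Adding these bounds and comparing the number of pieces with the number of trees, which is the sum
  of the floors, shows that the large components, and the small ones met by a heavy tree or by
  several light ones, are paid for by the heavy trees; every other small component is covered by a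
  single light tree. As the trees made from large components have weight at most \<open>4 * R\<close>, passing
  from sums of weights to sums of \<open>p\<close>-th powers costs a factor \<open>16 powr (p - 1)\<close>, and the argument
  in fact gives the constant 16.
\<close>

subsection \<open>Connectivity and spanning trees\<close>

lemma simple_graph_edgeD:
  assumes "simple_graph G" "{u, v} \<in> gedges G"
  shows "u \<in> gverts G" "v \<in> gverts G" "u \<noteq> v"
proof -
  obtain a b where "a \<in> gverts G" "b \<in> gverts G" "a \<noteq> b" "{u, v} = {a, b}"
    using assms unfolding simple_graph_def by blast
  then show "u \<in> gverts G" "v \<in> gverts G" "u \<noteq> v"
    by (auto simp: doubleton_eq_iff)
qed

lemma finite_gedges:
  assumes "simple_graph G"
  shows "finite (gedges G)"
proof (rule finite_subset)
  show "gedges G \<subseteq> Pow (gverts G)"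
    using assms by (auto simp: simple_graph_def)
qed (use assms in \<open>simp add: simple_graph_def\<close>)

section \<open>Reachability and connected components\<close>

lemma reachable_refl [simp]: "reachable G u u"
  by (simp add: reachable_def)

lemma reachable_trans: "reachable G u v \<Longrightarrow> reachable G v w \<Longrightarrow> reachable G u w"
  unfolding reachable_def by (rule rtranclp_trans)

lemma reachable_edge: "{u, v} \<in> gedges G \<Longrightarrow> reachable G u v"
  unfolding reachable_def by (rule r_into_rtranclp)

lemma reachable_induct [consumes 1, case_names refl step]:
  assumes "reachable G u v" "P u"
    and "\<And>x y. reachable G u x \<Longrightarrow> {x, y} \<in> gedges G \<Longrightarrow> P x \<Longrightarrow> P y"
  shows "P v"
  using assms(1) unfolding reachable_def
  by (induction rule: rtranclp_induct) (use assms(2,3) in \<open>auto simp: reachable_def\<close>)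

lemma reachable_sym: "reachable G u v \<Longrightarrow> reachable G v u"
proof (induction rule: reachable_induct)
  case (step x y)
  then have "reachable G y x" by (intro reachable_edge) (simp add: insert_commute)
  with step show ?case using reachable_trans by metis
qed simp

text \<open>Each edge of a walk in \<open>G\<close> may be replaced by a walk in \<open>H\<close>.
  This serves both for adding edges and for deleting a cycle edge, where the rest of the cycle is
  the replacement.\<close>

lemma reachable_substitute:
  assumes "reachable G u v"
    and "\<And>x y. {x, y} \<in> gedges G \<Longrightarrow> reachable H x y"
  shows "reachable H u v"
  using assms(1)
  by (induction rule: reachable_induct) (auto intro: reachable_trans assms(2))

lemma reachable_mono: "reachable G u v \<Longrightarrow> gedges G \<subseteq> gedges H \<Longrightarrow> reachable H u v"
  by (erule reachable_substitute) (auto intro: reachable_edge)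

lemma component_subset: "D \<in> graph_components G \<Longrightarrow> D \<subseteq> gverts G"
  by (auto simp: graph_components_def)

lemma component_nonempty: "D \<in> graph_components G \<Longrightarrow> D \<noteq> {}"
  unfolding graph_components_def using reachable_refl by fastforce

lemma component_reachable: "D \<in> graph_components G \<Longrightarrow> u \<in> D \<Longrightarrow> v \<in> D \<Longrightarrow> reachable G u v"
  by (auto simp: graph_components_def intro: reachable_trans reachable_sym)

lemma component_closed:
  "D \<in> graph_components G \<Longrightarrow> u \<in> D \<Longrightarrow> v \<in> gverts G \<Longrightarrow> reachable G u v \<Longrightarrow> v \<in> D"
  by (auto simp: graph_components_def intro: reachable_trans)

lemma component_eqI:
  assumes "D \<in> graph_components G" "D' \<in> graph_components G" "u \<in> D" "v \<in> D'" "reachable G u v"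
  shows "D = D'"
proof -
  have "x \<in> D \<longleftrightarrow> x \<in> D'" if "x \<in> gverts G" for x
    using component_closed[OF assms(1) assms(3) that] component_closed[OF assms(2) assms(4) that]
      component_reachable[OF assms(1) assms(3)] component_reachable[OF assms(2) assms(4)]
      assms(5) reachable_trans[of G u v x] reachable_trans[of G v u x] reachable_sym[of G u v] by blast
  with assms(1,2) show ?thesis using component_subset[of D G] component_subset[of D' G] by blast
qed

lemma component_exists: "u \<in> gverts G \<Longrightarrow> \<exists>D\<in>graph_components G. u \<in> D"
  unfolding graph_components_def by (rule bexI[of _ "{v \<in> gverts G. reachable G u v}"]) auto

lemma finite_graph_components: "finite (gverts G) \<Longrightarrow> finite (graph_components G)"
  by (rule finite_subset[of _ "Pow (gverts G)"]) (auto dest: component_subset)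

lemma graph_components_connected:
  assumes "graph_connected G"
  shows "graph_components G = {gverts G}"
  using assms unfolding graph_connected_def graph_components_def by auto

lemma simple_graph_induced:
  assumes "simple_graph G" "D \<subseteq> gverts G"
  shows "simple_graph (induced G D)"
  using assms finite_subset unfolding simple_graph_def induced_def by fastforce

lemma component_connected:
  assumes "simple_graph G" "D \<in> graph_components G"
  shows "graph_connected (induced G D)"
  unfolding graph_connected_def
proof (intro conjI ballI)
  show "gverts (induced G D) \<noteq> {}"
    using component_nonempty[OF assms(2)] by (simp add: induced_def)
next
  fix u v assume "u \<in> gverts (induced G D)" "v \<in> gverts (induced G D)"
  then have uv: "u \<in> D" "v \<in> D" by (auto simp: induced_def)
  then have "reachable G u v" by (rule component_reachable[OF assms(2)])
  \<comment> \<open>Membership in \<open>D\<close> is carried through the induction, so that every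
    edge of the walk is known to survive in the induced graph.\<close>
  then have "v \<in> D \<and> reachable (induced G D) u v"
  proof (induction rule: reachable_induct)
    case (step x y)
    then have "y \<in> D"
      using component_closed[OF assms(2) _ simple_graph_edgeD(2)[OF assms(1)] reachable_edge] by blast
    moreover have "reachable (induced G D) x y"
      using step calculation by (intro reachable_edge) (simp add: induced_def)
    ultimately show ?case using step reachable_trans[of _ u x y] by simp
  qed (use uv in auto)
  then show "reachable (induced G D) u v" ..
qed

text \<open>If a walk uses the new edge, its part before the first use and its part after the last
  use are walks in the old graph, and each of them ends or begins at \<open>a\<close> or
  \<open>b\<close>.\<close>

lemma reachable_insert_edge:
  assumes "reachable \<lparr>gverts = A, gedges = insert {a, b} E\<rparr> x y"
  shows "reachable \<lparr>gverts = A, gedges = E\<rparr> x y \<or>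
    (reachable \<lparr>gverts = A, gedges = E\<rparr> x a \<or> reachable \<lparr>gverts = A, gedges = E\<rparr> x b)
    \<and> (reachable \<lparr>gverts = A, gedges = E\<rparr> y a \<or> reachable \<lparr>gverts = A, gedges = E\<rparr> y b)"
  (is "?r x y \<or> ?s x \<and> ?s y")
  using assms
proof (induction rule: reachable_induct)
  case (step u v)
  show ?case
  proof (cases "{u, v} = {a, b}")
    case True
    then have "?s u" "?s v" by (auto simp: doubleton_eq_iff)
    with step.IH show ?thesis using reachable_trans by metis
  next
    case False
    with step.hyps have "?r u v" by (auto intro: reachable_edge)
    with step.IH show ?thesis using reachable_trans reachable_sym by metis
  qed
qed auto

text \<open>Only the component of \<open>a\<close> can be merged with another one by the new edge, so sending every
  other component to the one containing it is injective.\<close>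

lemma card_components_insert_edge:
  assumes "finite A"
  shows "card (graph_components \<lparr>gverts = A, gedges = E\<rparr>)
    \<le> Suc (card (graph_components \<lparr>gverts = A, gedges = insert {a, b} E\<rparr>))"
proof -
  let ?G = "\<lparr>gverts = A, gedges = E\<rparr>" and ?G' = "\<lparr>gverts = A, gedges = insert {a, b} E\<rparr>"
  define X where "X = {D \<in> graph_components ?G. \<forall>x\<in>D. \<not> reachable ?G x a}"
  have "\<forall>D\<in>X. \<exists>D'. D' \<in> graph_components ?G' \<and> D \<inter> D' \<noteq> {}"
  proof
    fix D assume D: "D \<in> X"
    then obtain x where "x \<in> D" "x \<in> A"
      using component_nonempty[of D ?G] component_subset[of D ?G] unfolding X_def by auto
    then show "\<exists>D'. D' \<in> graph_components ?G' \<and> D \<inter> D' \<noteq> {}"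
      using component_exists[of x ?G'] by auto
  qed
  then obtain f where f: "\<And>D. D \<in> X \<Longrightarrow> f D \<in> graph_components ?G' \<and> D \<inter> f D \<noteq> {}"
    by metis
  have "inj_on f X"
  proof (rule inj_onI)
    fix D D' assume DD: "D \<in> X" "D' \<in> X" "f D = f D'"
    then obtain x y where xy: "x \<in> D" "x \<in> f D" "y \<in> D'" "y \<in> f D"
      using f by (metis disjoint_iff)
    then have "reachable ?G' x y" using component_reachable[of "f D" ?G' x y] f[OF DD(1)] by simp
    moreover have "\<not> reachable ?G x a" "\<not> reachable ?G y a"
      using DD xy by (auto simp: X_def)
    \<comment> \<open>With \<open>a\<close> excluded for both vertices, a walk through the new edge
      would leave both of them connected to \<open>b\<close> in the old graph, hence to each
      other.\<close>
    ultimately have "reachable ?G x y"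
      using reachable_insert_edge[of A a b E x y] reachable_trans[of ?G x b y] reachable_sym[of ?G y b]
      by blast
    then show "D = D'" using component_eqI[of D ?G D' x y] xy DD unfolding X_def by simp
  qed
  moreover have fin: "finite (graph_components ?G')" "finite X"
    using assms finite_graph_components[of ?G] finite_graph_components[of ?G']
    by (auto simp: X_def)
  ultimately have "card X \<le> card (graph_components ?G')"
    using f by (auto intro: card_inj_on_le)
  moreover have "card (graph_components ?G - X) \<le> 1"
  proof (rule card_le_Suc0_iff_eq[THEN iffD2, folded One_nat_def])
    show "finite (graph_components ?G - X)" using assms finite_graph_components[of ?G] by auto
    show "\<forall>D\<in>graph_components ?G - X. \<forall>D'\<in>graph_components ?G - X. D = D'"
    proof (intro ballI)
      fix D D' assume D: "D \<in> graph_components ?G - X" "D' \<in> graph_components ?G - X"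
      then obtain x y where xy: "x \<in> D" "y \<in> D'" "reachable ?G x a" "reachable ?G y a"
        by (auto simp: X_def)
      then have "reachable ?G x y" using reachable_trans[of ?G x a y] reachable_sym[of ?G y a] by simp
      with D xy show "D = D'" using component_eqI[of D ?G D' x y] by simp
    qed
  qed
  moreover have "card (graph_components ?G) = card X + card (graph_components ?G - X)"
    using assms finite_graph_components[of ?G] 
    by (subst card_Un_disjoint[symmetric]) (auto simp: X_def intro!: arg_cong[of _ _ card])
  ultimately show ?thesis by linarith
qed

text \<open>The removed edges are put back one at a time, each lowering the number of components by
  at most one.\<close>

lemma card_components_le_removed_edges:
  assumes "finite A" "finite L" "\<forall>e\<in>L. \<exists>a b. e = {a, b}"
  shows "card (graph_components \<lparr>gverts = A, gedges = E\<rparr>)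
    \<le> card (graph_components \<lparr>gverts = A, gedges = E \<union> L\<rparr>) + card L"
  using assms(2,3)
proof (induction rule: finite_induct)
  case (insert e L)
  then obtain a b where "e = {a, b}" by auto
  then have "card (graph_components \<lparr>gverts = A, gedges = E \<union> L\<rparr>)
      \<le> Suc (card (graph_components \<lparr>gverts = A, gedges = E \<union> insert e L\<rparr>))"
    using card_components_insert_edge[OF assms(1), of "E \<union> L" a b] by simp
  with insert show ?case by simp
qed simp

section \<open>Spanning trees by deleting cycle edges\<close>

lemma reachable_cycle_minus_edge:
  assumes "is_cycle G xs"
  shows "reachable (G\<lparr>gedges := gedges G - {{last xs, hd xs}}\<rparr>) (hd xs) (last xs)"
proof -
  let ?H = "G\<lparr>gedges := gedges G - {{last xs, hd xs}}\<rparr>"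
  have len: "length xs \<ge> 3" and dist: "distinct xs"
    and ed: "\<And>i. i < length xs \<Longrightarrow> {xs ! i, xs ! (Suc i mod length xs)} \<in> gedges G"
    using assms by (auto simp: is_cycle_def)
  have h: "hd xs = xs ! 0" and l: "last xs = xs ! (length xs - 1)"
    using len hd_conv_nth[of xs] last_conv_nth[of xs] by fastforce+
  have "i < length xs \<Longrightarrow> reachable ?H (hd xs) (xs ! i)" for i
  proof (induction i)
    case 0 then show ?case by (simp add: h)
  next
    case (Suc i)
    have "{xs ! i, xs ! Suc i} \<in> gedges G" using ed[of i] Suc.prems by simp
    \<comment> \<open>Since the entries are distinct, equality would force \<open>i = 0\<close> and
      \<open>Suc i = length xs - 1\<close>, that is, a list of length 2.\<close>
    moreover have "{xs ! i, xs ! Suc i} \<noteq> {last xs, hd xs}"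
    proof
      assume "{xs ! i, xs ! Suc i} = {last xs, hd xs}"
      then have "xs ! Suc i = xs ! 0 \<or> xs ! i = xs ! 0 \<and> xs ! Suc i = xs ! (length xs - 1)"
        unfolding h l doubleton_eq_iff by auto
      moreover have "xs ! a = xs ! b \<longleftrightarrow> a = b" if "a < length xs" "b < length xs" for a b
        using nth_eq_iff_index_eq[OF dist that] .
      moreover have "0 < length xs" "length xs - 1 < length xs" "i < length xs"
        using len Suc.prems by linarith+
      ultimately have "i = 0 \<and> Suc i = length xs - 1"
        using Suc.prems by auto
      with len show False by linarith
    qed
    ultimately have "reachable ?H (xs ! i) (xs ! Suc i)" by (intro reachable_edge) simp
    then show ?case using reachable_trans[of ?H "hd xs" "xs ! i" "xs ! Suc i"] Suc by simp
  qed
  then show ?thesis using len by (simp add: l)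
qed

text \<open>Induction on the number of edges: as long as there is a cycle, its closing edge can be
  deleted without destroying connectedness, because the remaining edges of the cycle bypass
  it.\<close>

lemma spanning_tree_exists:
  assumes "simple_graph G" "graph_connected G"
  shows "\<exists>T. spanning_tree T G"
  using assms
proof (induction "card (gedges G)" arbitrary: G rule: less_induct)
  case less
  show ?case
  proof (cases "\<exists>xs. is_cycle G xs")
    case False
    then have "spanning_tree G G"
      using less.prems by (auto simp: spanning_tree_def is_tree_def subgraph_def)
    then show ?thesis ..
  next
    case True
    then obtain xs where xs: "is_cycle G xs" ..
    define H where "H = G\<lparr>gedges := gedges G - {{last xs, hd xs}}\<rparr>"
    have "length xs \<ge> 3" using xs by (simp add: is_cycle_def)
    then have "hd xs = xs ! 0" "last xs = xs ! (length xs - 1)" "Suc (length xs - 1) = length xs"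
      using hd_conv_nth[of xs] last_conv_nth[of xs] by fastforce+
    \<comment> \<open>The closing edge is the one at index \<open>length xs - 1\<close>, where the
      successor wraps round to 0.\<close>
    then have e: "{last xs, hd xs} \<in> gedges G"
      using xs unfolding is_cycle_def by (metis lessI mod_self)
    then have "card (gedges H) < card (gedges G)"
      using finite_gedges[OF less.prems(1)] by (auto simp: H_def intro!: psubset_card_mono simp del: card_Diff_insert)
    moreover have "simple_graph H"
      using less.prems(1) by (auto simp: H_def simple_graph_def)
    moreover have "graph_connected H"
    proof -
      have "reachable H x y" if "{x, y} \<in> gedges G" for x y
      proof (cases "{x, y} = {last xs, hd xs}")
        case True
        then show ?thesis
          using reachable_cycle_minus_edge[OF xs, folded H_def] reachable_sym[of H "hd xs" "last xs"]
          by (auto simp: doubleton_eq_iff)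
      next
        case False
        with that show ?thesis by (intro reachable_edge) (simp add: H_def)
      qed
      then show ?thesis
        using less.prems(2) reachable_substitute[of G _ _ H]
        unfolding graph_connected_def by (simp add: H_def)
    qed
    ultimately obtain T where "spanning_tree T H" using less.hyps by blast
    then have "spanning_tree T G"
      using less.prems(1) by (auto simp: spanning_tree_def subgraph_def H_def)
    then show ?thesis ..
  qed
qed

lemma weight_mono:
  assumes "simple_graph G" "gedges H \<subseteq> gedges G" "\<And>e. e \<in> gedges G \<Longrightarrow> 0 \<le> edge_length d e"
  shows "weight d H \<le> weight d G"
  unfolding weight_def using assms finite_gedges by (intro sum_mono2) auto

text \<open>Thinning \<open>K\<close> out to a spanning tree only lowers its weight. Thus a graph
  built to bound the minimum may contain cycles.\<close>

lemma min_spanning_tree_le_connected: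
  assumes "min_spanning_tree d T G" "subgraph K G" "graph_connected K" "gverts K = gverts G"
    and "\<And>e. e \<in> gedges G \<Longrightarrow> 0 \<le> edge_length d e"
  shows "weight d T \<le> weight d K"
proof -
  have K: "simple_graph K" using assms(2) by (simp add: subgraph_def)
  then obtain S where S: "spanning_tree S K" using spanning_tree_exists assms(3) by blast
  then have "spanning_tree S G"
    using assms(2,4) by (auto simp: spanning_tree_def subgraph_def)
  then have "weight d T \<le> weight d S" using assms(1) by (auto simp: min_spanning_tree_def)
  also have "\<dots> \<le> weight d K"
    using S K assms(2,5) by (intro weight_mono) (auto simp: spanning_tree_def subgraph_def)
  finally show ?thesis .
qed

section \<open>Joining connected pieces\<close>

lemma connected_union_edge:
  assumes "graph_connected G" "graph_connected H" "u \<in> gverts G" "v \<in> gverts H"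
  shows "graph_connected \<lparr>gverts = gverts G \<union> gverts H, gedges = insert {u, v} (gedges G \<union> gedges H)\<rparr>"
    (is "graph_connected ?K")
proof -
  have "reachable ?K u x" if "x \<in> gverts G \<union> gverts H" for x
  proof (cases "x \<in> gverts G")
    case True
    then have "reachable G u x" using assms by (auto simp: graph_connected_def)
    then show ?thesis by (rule reachable_mono) auto
  next
    case False
    then have "reachable H v x" using assms that by (auto simp: graph_connected_def)
    then have "reachable ?K v x" by (rule reachable_mono) auto
    moreover have "reachable ?K u v" by (rule reachable_edge) simp
    ultimately show ?thesis using reachable_trans[of ?K u v x] by simp
  qed
  then have "reachable ?K x y" if "x \<in> gverts ?K" "y \<in> gverts ?K" for x y
    using that reachable_trans[of ?K x u y] reachable_sym[of ?K u x] by simp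
  then show ?thesis using assms(3) unfolding graph_connected_def by auto
qed

lemma connected_crossing_edge:
  assumes "graph_connected G" "A \<subseteq> gverts G" "A \<noteq> {}" "A \<noteq> gverts G"
  shows "\<exists>u\<in>A. \<exists>v. v \<notin> A \<and> {u, v} \<in> gedges G"
proof (rule ccontr)
  assume no: "\<not> ?thesis"
  obtain a b where ab: "a \<in> A" "b \<in> gverts G" "b \<notin> A" using assms by blast
  then have "reachable G a b" using assms by (auto simp: graph_connected_def)
  then have "b \<in> A" by (induction rule: reachable_induct) (use ab no in auto)
  with ab show False by simp
qed

text \<open>The pieces are joined one after the other, each time along an edge of \<open>G\<close> leaving the part
  built so far.\<close>

lemma connect_pieces:
  assumes G: "simple_graph G" "graph_connected G"
    and len: "\<And>e. e \<in> gedges G \<Longrightarrow> 0 \<le> edge_length d e \<and> edge_length d e \<le> R" "R \<ge> 0"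
    and J: "finite J" "J \<noteq> {}"
    and H: "\<And>j. j \<in> J \<Longrightarrow> subgraph (H j) G \<and> graph_connected (H j)"
    and cover: "gverts G \<subseteq> (\<Union>j\<in>J. gverts (H j))"
  shows "\<exists>K. subgraph K G \<and> graph_connected K \<and> gverts K = gverts G
    \<and> weight d K \<le> (\<Sum>j\<in>J. weight d (H j)) + (real (card J) - 1) * R"
proof -
  have nn: "0 \<le> weight d (H j)" if "j \<in> J" for j
    unfolding weight_def using H[OF that] len(1) by (auto intro!: sum_nonneg simp: subgraph_def)
  \<comment> \<open>Which piece can be attached next depends on the edges that leave the current
    part. A maximal subfamily \<open>J'\<close> that can be joined within the bound is therefore
    taken, instead of an induction along a fixed order of \<open>J\<close>.\<close>
  define P where "P K J' \<longleftrightarrow> J' \<subseteq> J \<and> J' \<noteq> {} \<and> subgraph K G \<and> graph_connected K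
    \<and> gverts K = (\<Union>j\<in>J'. gverts (H j))
    \<and> weight d K \<le> (\<Sum>j\<in>J'. weight d (H j)) + (real (card J') - 1) * R" for K J'
  obtain j0 where "j0 \<in> J" using J by blast
  then have "P (H j0) {j0}" using H by (auto simp: P_def)
  then have "{J'. \<exists>K. P K J'} \<noteq> {}" by blast
  moreover have "finite {J'. \<exists>K. P K J'}"
    by (rule finite_subset[of _ "Pow J"]) (use J in \<open>auto simp: P_def\<close>)
  ultimately obtain J' where "J' \<in> {J'. \<exists>K. P K J'}"
    and max: "\<And>J''. J'' \<in> {J'. \<exists>K. P K J'} \<Longrightarrow> J' \<subseteq> J'' \<Longrightarrow> J' = J''"
    using finite_has_maximal by (metis (no_types, lifting))
  then obtain K where K: "P K J'" by blast
  have finJ': "finite J'" using K J finite_subset by (auto simp: P_def)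
  have "gverts K = gverts G"
  proof (rule ccontr)
    assume "gverts K \<noteq> gverts G"
    moreover have "gverts K \<subseteq> gverts G" "gverts K \<noteq> {}"
      using K unfolding P_def subgraph_def graph_connected_def by metis+
    ultimately obtain u v where uv: "u \<in> gverts K" "v \<notin> gverts K" "{u, v} \<in> gedges G"
      using connected_crossing_edge[OF G(2)] by blast
    then have "v \<in> gverts G" using simple_graph_edgeD G by metis
    then obtain j where j: "j \<in> J" "v \<in> gverts (H j)" using cover by blast
    with uv K have j': "j \<notin> J'" by (auto simp: P_def)
    define K' where "K' = \<lparr>gverts = gverts K \<union> gverts (H j),
      gedges = insert {u, v} (gedges K \<union> gedges (H j))\<rparr>"
    have Hj: "subgraph (H j) G" "graph_connected (H j)" using H j by auto
    have sub: "subgraph K' G"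
    proof -
      have "simple_graph K" "simple_graph (H j)" using K Hj by (auto simp: P_def subgraph_def)
      moreover have "u \<in> gverts K'" "v \<in> gverts K'" "u \<noteq> v"
        using uv j by (auto simp: K'_def)
      ultimately have "simple_graph K'"
        unfolding simple_graph_def K'_def by simp blast
      then show ?thesis using K Hj uv(3) by (auto simp: P_def subgraph_def K'_def)
    qed
    \<comment> \<open>The pieces may overlap in edges, so only subadditivity is available.\<close>
    have "weight d K' \<le> edge_length d {u, v} + (weight d K + weight d (H j))"
    proof -
      have fin: "finite (gedges K)" "finite (gedges (H j))"
        using K Hj finite_gedges by (auto simp: P_def subgraph_def)
      have "sum (edge_length d) (gedges K \<union> gedges (H j))
          \<le> sum (edge_length d) (gedges K) + sum (edge_length d) (gedges (H j))"
        using fin len K Hj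
        by (subst sum_Un) (auto intro!: sum_nonneg simp: P_def subgraph_def)
      moreover have "sum (edge_length d) (insert {u, v} (gedges K \<union> gedges (H j)))
          \<le> edge_length d {u, v} + sum (edge_length d) (gedges K \<union> gedges (H j))"
        using fin len(1)[OF uv(3)] by (simp add: sum.insert_if)
      ultimately show ?thesis by (simp add: weight_def K'_def)
    qed
    also have "\<dots> \<le> R + ((\<Sum>j\<in>J'. weight d (H j)) + (real (card J') - 1) * R + weight d (H j))"
      using len(1)[OF uv(3)] K by (auto simp: P_def)
    also have "\<dots> = (\<Sum>j\<in>insert j J'. weight d (H j)) + (real (card (insert j J')) - 1) * R"
      using finJ' j' by (simp add: algebra_simps)
    finally have "P K' (insert j J')"
      using K j sub connected_union_edge[of K "H j" u v] Hj uv
      by (auto simp: P_def K'_def)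
    then have "J' = insert j J'" using max by blast
    with j' show False by blast
  qed
  \<comment> \<open>\<open>J'\<close> may miss pieces whose vertices are already covered; passing to
    all of \<open>J\<close> only increases the bound, as weights and \<open>R\<close> are
    nonnegative.\<close>
  moreover have "(\<Sum>j\<in>J'. weight d (H j)) \<le> (\<Sum>j\<in>J. weight d (H j))"
    using K J nn by (intro sum_mono2) (auto simp: P_def)
  moreover have "(real (card J') - 1) * R \<le> (real (card J) - 1) * R"
    using K J len(2) card_mono by (intro mult_right_mono) (auto simp: P_def)
  ultimately show ?thesis using K by (intro exI[of _ K]) (auto simp: P_def)
qed

subsection \<open>Counting pieces\<close>

text \<open>This bound and the next one turn \<open>p\<close>-th powers into linear terms: this one
  from above for weights up to \<open>4 * R\<close>, the next one from below for heavy trees, where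
  \<open>y = R / 4\<close>.\<close>

lemma powr_le_mult:
  fixes x y p :: real
  assumes "0 \<le> x" "x \<le> y" "1 \<le> p"
  shows "x powr p \<le> y powr (p - 1) * x"
proof (cases "x = 0")
  case False
  have "x powr p = x powr (p - 1) * x powr 1" by (simp only: powr_add[symmetric]) simp
  also have "\<dots> \<le> y powr (p - 1) * x"
    using assms False by (simp add: mult_right_mono powr_mono2)
  finally show ?thesis .
qed simp

lemma powr_ge_mult:
  fixes x y p :: real
  assumes "0 < y" "y \<le> x" "1 \<le> p"
  shows "y powr (p - 1) * x \<le> x powr p"
proof -
  have "y powr (p - 1) * x \<le> x powr (p - 1) * x powr 1"
    using assms by (simp add: mult_right_mono powr_mono2)
  also have "\<dots> = x powr p" by (simp only: powr_add[symmetric]) simp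
  finally show ?thesis .
qed

lemma floor_excess:
  fixes x R :: real
  assumes "0 < R"
  shows "0 \<le> x \<Longrightarrow> x < 2 * R \<Longrightarrow> \<lfloor>(x + 2 * R) / (2 * R)\<rfloor> = 1"
    and "R * of_int \<lfloor>(x + 2 * R) / (2 * R)\<rfloor> \<le> x / 2 + R"
proof -
  show "\<lfloor>(x + 2 * R) / (2 * R)\<rfloor> = 1" if "0 \<le> x" "x < 2 * R"
    using that assms by (intro floor_unique) (auto simp: field_simps)
  have "R * of_int \<lfloor>(x + 2 * R) / (2 * R)\<rfloor> \<le> R * ((x + 2 * R) / (2 * R))"
    using assms by (intro mult_left_mono of_int_floor_le) auto
  also have "\<dots> = x / 2 + R" using assms by (simp add: field_simps)
  finally show "R * of_int \<lfloor>(x + 2 * R) / (2 * R)\<rfloor> \<le> x / 2 + R" .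
qed

text \<open>Here \<open>q i C\<close> and \<open>s i C\<close> are the number and the total weight of the pieces inside \<open>C\<close> into
  which the tree \<open>i\<close>, of weight \<open>W i\<close>, splits when its \<open>n i\<close> edges longer than \<open>R\<close> are deleted, and
  \<open>w C\<close> is the weight of a minimum spanning tree of \<open>C\<close>.\<close>

lemma piece_counting_bound:
  fixes q :: "'i \<Rightarrow> 'c \<Rightarrow> nat" and s :: "'i \<Rightarrow> 'c \<Rightarrow> real" and n :: "'i \<Rightarrow> nat"
    and W :: "'i \<Rightarrow> real" and w :: "'c \<Rightarrow> real" and R p :: real
  assumes fin: "finite I" "finite \<C>" and R: "R > 0" and p: "p \<ge> 1"
    and s0: "\<And>i C. i \<in> I \<Longrightarrow> C \<in> \<C> \<Longrightarrow> 0 \<le> s i C"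
    and sq: "\<And>i C. i \<in> I \<Longrightarrow> C \<in> \<C> \<Longrightarrow> q i C = 0 \<Longrightarrow> s i C = 0"
    and qn: "\<And>i. i \<in> I \<Longrightarrow> (\<Sum>C\<in>\<C>. q i C) \<le> n i + 1"
    and sW: "\<And>i. i \<in> I \<Longrightarrow> (\<Sum>C\<in>\<C>. s i C) + n i * R \<le> W i"
    and w0: "\<And>C. C \<in> \<C> \<Longrightarrow> 0 \<le> w C"
    and ws: "\<And>C. C \<in> \<C> \<Longrightarrow> w C \<le> (\<Sum>i\<in>I. s i C) + (real (\<Sum>i\<in>I. q i C) - 1) * R"
    and cov: "\<And>C. C \<in> \<C> \<Longrightarrow> 1 \<le> (\<Sum>i\<in>I. q i C)"
    and card: "(\<Sum>C\<in>\<C>. \<lfloor>(w C + 2 * R) / (2 * R)\<rfloor>) = int (card I)"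
  shows "(\<Sum>C\<in>{C \<in> \<C>. w C \<ge> 2 * R}. (4 * R) powr (p - 1) * w C)
      + (\<Sum>C\<in>{C \<in> \<C>. w C < 2 * R}. w C powr p)
      \<le> 16 powr p * (\<Sum>i\<in>I. W i powr p)"
proof -
  define Hv where "Hv = {i \<in> I. W i \<ge> R / 4}"
  define Lt where "Lt = {i \<in> I. W i < R / 4}"
  have I: "finite Hv" "finite Lt" "\<And>i. i \<in> Hv \<Longrightarrow> i \<in> I" "\<And>i. i \<in> Lt \<Longrightarrow> i \<in> I"
    "\<And>i. i \<in> I \<Longrightarrow> i \<in> Hv \<or> i \<in> Lt"
    using fin by (auto simp: Hv_def Lt_def)
  have IU: "I = Hv \<union> Lt" "Hv \<inter> Lt = {}" by (auto simp: Hv_def Lt_def)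
  have sumI: "sum g I = sum g Hv + sum g Lt" for g :: "'i \<Rightarrow> real"
    unfolding IU(1) using I(1,2) IU(2) by (rule sum.union_disjoint)
  have sumIn: "sum g I = sum g Hv + sum g Lt" for g :: "'i \<Rightarrow> nat"
    unfolding IU(1) using I(1,2) IU(2) by (rule sum.union_disjoint)
  have cardI: "card I = card Hv + card Lt"
    unfolding IU(1) using I(1,2) IU(2) by (rule card_Un_disjoint)
  define h where "h C = (\<Sum>i\<in>Hv. q i C)" for C
  define l where "l C = (\<Sum>i\<in>Lt. q i C)" for C
  define sh where "sh C = (\<Sum>i\<in>Hv. s i C)" for C
  define f where "f C = real_of_int \<lfloor>(w C + 2 * R) / (2 * R)\<rfloor>" for C
  define A where "A = (\<Sum>C\<in>{C \<in> \<C>. w C \<ge> 2 * R}. w C)"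
  \<comment> \<open>\<open>b\<close> marks the small components met by light pieces only, but by at
    least two of them. Each has a piece in excess of its floor term 1, and this excess pays for
    it.\<close>
  define b where "b C = (if w C < 2 * R \<and> h C = 0 \<and> l C \<ge> 2 then 1 else 0 :: real)" for C
  define S where "S = (\<Sum>i\<in>Hv. W i)"
  have sleW: "s i C \<le> W i" if "i \<in> I" "C \<in> \<C>" for i C
  proof -
    have "s i C \<le> (\<Sum>C\<in>\<C>. s i C)" using s0 that fin by (intro member_le_sum) auto
    moreover have "0 \<le> n i * R" using R by simp
    ultimately show ?thesis using sW[OF that(1)] by linarith
  qed
  \<comment> \<open>One long edge alone accounts for \<open>R\<close> in \<open>sW\<close>, more
    than a light tree weighs.\<close>
  have light_n: "n i = 0" if "i \<in> Lt" for i
  proof (rule ccontr)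
    assume "n i \<noteq> 0"
    then have "R \<le> n i * R" using R by (simp add: Suc_le_eq)
    moreover have "0 \<le> (\<Sum>C\<in>\<C>. s i C)" using s0 that I by (auto intro!: sum_nonneg)
    moreover have "i \<in> I" "W i < R / 4" using that by (auto simp: Lt_def)
    ultimately show False using sW[of i] R by linarith
  qed
  have light_q: "(\<Sum>C\<in>\<C>. q i C) \<le> 1" if "i \<in> Lt" for i
    using qn[OF I(4)[OF that]] light_n[OF that] by simp
  have light_s: "s i C \<le> R / 4 * q i C" if "i \<in> Lt" "C \<in> \<C>" for i C
  proof (cases "q i C = 0")
    case True
    then show ?thesis using sq[OF I(4)] that by simp
  next
    case False
    then have "R / 4 * 1 \<le> R / 4 * q i C" using R by (intro mult_left_mono) auto
    moreover have "s i C \<le> W i" "W i < R / 4" using sleW[OF I(4)] that by (auto simp: Lt_def)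
    ultimately show ?thesis by linarith
  qed
  have sum_l: "(\<Sum>C\<in>\<C>. l C) \<le> card Lt"
  proof -
    have "(\<Sum>C\<in>\<C>. l C) = (\<Sum>i\<in>Lt. \<Sum>C\<in>\<C>. q i C)" unfolding l_def by (rule sum.swap)
    also have "\<dots> \<le> (\<Sum>i\<in>Lt. 1)" by (intro sum_mono light_q)
    finally show ?thesis by simp
  qed
  have sum_h: "(\<Sum>C\<in>\<C>. h C) \<le> (\<Sum>i\<in>Hv. n i) + card Hv"
  proof -
    have "(\<Sum>C\<in>\<C>. h C) = (\<Sum>i\<in>Hv. \<Sum>C\<in>\<C>. q i C)" unfolding h_def by (rule sum.swap)
    also have "\<dots> \<le> (\<Sum>i\<in>Hv. n i + 1)" using I by (intro sum_mono qn) auto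
    also have "\<dots> = (\<Sum>i\<in>Hv. n i) + card Hv" by (simp only: sum.distrib card_eq_sum)
    finally show ?thesis .
  qed
  have sum_sh: "(\<Sum>C\<in>\<C>. sh C) + R * (\<Sum>i\<in>Hv. n i) \<le> S"
  proof -
    have "(\<Sum>C\<in>\<C>. sh C) = (\<Sum>i\<in>Hv. \<Sum>C\<in>\<C>. s i C)" unfolding sh_def by (rule sum.swap)
    then have "(\<Sum>C\<in>\<C>. sh C) + R * (\<Sum>i\<in>Hv. n i) = (\<Sum>i\<in>Hv. (\<Sum>C\<in>\<C>. s i C) + n i * R)"
      by (simp add: sum.distrib sum_distrib_left mult.commute)
    also have "\<dots> \<le> S" unfolding S_def using I by (intro sum_mono sW) auto
    finally show ?thesis .
  qed
  have sh0: "0 \<le> sh C" if "C \<in> \<C>" for C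
    unfolding sh_def using s0 that I by (auto intro!: sum_nonneg)
  have hl: "1 \<le> h C + l C" if "C \<in> \<C>" for C
    using cov[OF that] by (simp add: h_def l_def sumIn)
  \<comment> \<open>Each light piece costs at most \<open>R / 4\<close> for itself and
    \<open>R\<close> for joining it. Heavy pieces are charged \<open>5 / 4 * R\<close> as well, so
    that all pieces carry one common factor and can be compared with the number of trees.\<close>
  have wC: "w C \<le> sh C + 5 / 4 * R * (h C + l C) - R" if "C \<in> \<C>" for C
  proof -
    have "(\<Sum>i\<in>Lt. s i C) \<le> (\<Sum>i\<in>Lt. R / 4 * q i C)" using that by (intro sum_mono light_s)
    also have "\<dots> = R / 4 * l C" by (simp add: l_def sum_distrib_left)
    finally have "w C \<le> sh C + R / 4 * l C + (real (h C + l C) - 1) * R"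
      using ws[OF that] unfolding sumI sumIn h_def l_def sh_def by linarith
    moreover have "(real (h C + l C) - 1) * R = 5 / 4 * R * (h C + l C) - R - R / 4 * h C - R / 4 * l C"
      by (simp add: field_simps)
    moreover have "0 \<le> R / 4 * h C" using R by simp
    ultimately show ?thesis by linarith
  qed
  have "(if w C \<ge> 2 * R then w C else 0) / 4 + 5 / 4 * R * b C
      \<le> sh C + 5 / 4 * R * (h C + l C - f C)" if C: "C \<in> \<C>" for C
  proof (cases "w C \<ge> 2 * R")
    case True
    \<comment> \<open>By \<open>wC\<close>, the right-hand side is at least
      \<open>w C + R - 5 / 4 * (w C / 2 + R) = 3 / 8 * w C - R / 4\<close>, and
      \<open>w C \<ge> 2 * R\<close> makes this at least \<open>w C / 4\<close>.\<close>
    have "R * f C \<le> w C / 2 + R" unfolding f_def by (rule floor_excess(2)[OF R])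
    moreover have "5 / 4 * R * (h C + l C - f C) = 5 / 4 * R * (h C + l C) - 5 / 4 * (R * f C)"
      by (simp add: field_simps)
    moreover have "(if w C \<ge> 2 * R then w C else 0) = w C" "5 / 4 * R * b C = 0"
      using True by (auto simp: b_def)
    ultimately show ?thesis using wC[OF C] True unfolding of_nat_add by linarith
  next
    case False
    have "f C = 1" using floor_excess(1)[OF R w0[OF C]] False by (simp add: f_def)
    moreover have "b C \<le> real (h C + l C) - 1" using hl[OF C] by (auto simp: b_def)
    then have "R * b C \<le> R * (real (h C + l C) - 1)" using R by (intro mult_left_mono) auto
    moreover have "5 / 4 * R * (real (h C) + real (l C) - 1) = 5 / 4 * (R * (real (h C + l C) - 1))"
      by simp
    ultimately show ?thesis using False sh0[OF C] by simp
  qed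
  then have "(\<Sum>C\<in>\<C>. (if w C \<ge> 2 * R then w C else 0) / 4 + 5 / 4 * R * b C)
      \<le> (\<Sum>C\<in>\<C>. sh C + 5 / 4 * R * (h C + l C - f C))" by (rule sum_mono)
  also have "(\<Sum>C\<in>\<C>. (if w C \<ge> 2 * R then w C else 0) / 4 + 5 / 4 * R * b C)
      = A / 4 + 5 / 4 * R * (\<Sum>C\<in>\<C>. b C)"
    using fin by (simp add: A_def sum.distrib sum_distrib_left sum_divide_distrib sum.inter_filter)
  also have "(\<Sum>C\<in>\<C>. sh C + 5 / 4 * R * (h C + l C - f C))
      = (\<Sum>C\<in>\<C>. sh C) + 5 / 4 * R * (real (\<Sum>C\<in>\<C>. h C) + real (\<Sum>C\<in>\<C>. l C) - (\<Sum>C\<in>\<C>. f C))"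
    by (simp only: sum.distrib sum_subtractf sum_distrib_left[symmetric] of_nat_sum of_nat_add)
  also have "(\<Sum>C\<in>\<C>. f C) = real (card I)"
    using card by (metis (mono_tags, lifting) f_def of_int_of_nat_eq of_int_sum sum.cong)
  \<comment> \<open>Every tree has one piece for free, and light trees have no further ones. The
    surplus of pieces over trees is at most the number of long edges of heavy trees.\<close>
  also have "real (\<Sum>C\<in>\<C>. h C) + real (\<Sum>C\<in>\<C>. l C) - real (card I) \<le> real (\<Sum>i\<in>Hv. n i)"
    using sum_h sum_l cardI by linarith
  finally have "A / 4 + 5 / 4 * R * (\<Sum>C\<in>\<C>. b C)
      \<le> (\<Sum>C\<in>\<C>. sh C) + 5 / 4 * R * real (\<Sum>i\<in>Hv. n i)"
    using R by simp
  moreover have "0 \<le> (\<Sum>C\<in>\<C>. sh C)" using sh0 by (rule sum_nonneg)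
  ultimately have main: "A + 5 * R * (\<Sum>C\<in>\<C>. b C) \<le> 5 * S"
    using sum_sh unfolding mult.assoc by linarith
  \<comment> \<open>The long edges contribute at most \<open>S\<close>, and the one extra piece per
    heavy tree at most \<open>4 * S\<close>, by the threshold \<open>R / 4\<close>.\<close>
  have heavy_count: "R * (\<Sum>C\<in>\<C>. h C) \<le> 5 * S"
  proof -
    have "R * real (card Hv) = (\<Sum>i\<in>Hv. R)" by simp
    also have "\<dots> \<le> (\<Sum>i\<in>Hv. 4 * W i)" by (rule sum_mono) (simp add: Hv_def)
    also have "\<dots> = 4 * S" by (simp add: S_def sum_distrib_left)
    finally have "R * real (card Hv) \<le> 4 * S" .
    moreover have "R * real (\<Sum>C\<in>\<C>. h C) \<le> R * real ((\<Sum>i\<in>Hv. n i) + card Hv)"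
      using R sum_h by (intro mult_left_mono of_nat_mono) auto
    moreover have "0 \<le> (\<Sum>C\<in>\<C>. sh C)" using sh0 by (rule sum_nonneg)
    ultimately show ?thesis using sum_sh unfolding of_nat_add distrib_left by linarith
  qed
  have small: "w C powr p \<le> (2 * R) powr p * (b C + h C) + (\<Sum>i\<in>Lt. q i C * W i powr p)"
    if C: "C \<in> \<C>" "w C < 2 * R" for C
  proof -
    have nn: "0 \<le> (\<Sum>i\<in>Lt. q i C * W i powr p)" by (intro sum_nonneg) auto
    have le: "w C powr p \<le> (2 * R) powr p" using C w0 p by (intro powr_mono2) auto
    consider "h C \<ge> 1" | "h C = 0" "l C \<ge> 2" | "h C = 0" "l C = 1" using hl[OF C(1)] by linarith
    then show ?thesis
    proof cases
      case 1
      then have "(2 * R) powr p * 1 \<le> (2 * R) powr p * (b C + h C)"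
        by (intro mult_left_mono) (auto simp: b_def)
      then show ?thesis using le nn by linarith
    next
      case 2
      then show ?thesis using le nn C by (simp add: b_def)
    next
      case 3
      then obtain i where i: "i \<in> Lt" "q i C = 1" "\<And>j. j \<in> Lt \<Longrightarrow> j \<noteq> i \<Longrightarrow> q j C = 0"
        using sum_eq_1_iff[OF I(2)] unfolding l_def by metis
      \<comment> \<open>The only piece inside \<open>C\<close> belongs to the light tree
        \<open>i\<close>. Nothing has to be joined, the term \<open>(1 - 1) * R\<close> in
        \<open>ws\<close> vanishes, and \<open>w C\<close> is at most \<open>W i\<close>.\<close>
      have "q j C = 0" if "j \<in> I" "j \<noteq> i" for j
        using i(3)[of j] I(1) I(5)[OF that(1)] 3(1) that(2) by (auto simp: h_def)
      then have "(\<Sum>j\<in>I. s j C) = (\<Sum>j\<in>{i}. s j C)"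
        using i I fin C by (intro sum.mono_neutral_right) (auto intro: sq)
      moreover have "(\<Sum>j\<in>I. q j C) = 1"
        using 3 by (simp add: h_def l_def sumIn)
      ultimately have "w C \<le> s i C" using ws[OF C(1)] by simp
      also have "\<dots> \<le> W i" using sleW i I C by blast
      finally have "w C powr p \<le> q i C * W i powr p"
        using i w0[OF C(1)] p by (simp add: powr_mono2)
      also have "\<dots> \<le> (\<Sum>i\<in>Lt. q i C * W i powr p)" using i I by (intro member_le_sum) auto
      finally show ?thesis using 3 by (simp add: b_def)
    qed
  qed
  have b0: "0 \<le> b C" for C by (simp add: b_def)
  have "(\<Sum>C\<in>{C \<in> \<C>. w C < 2 * R}. w C powr p)
      \<le> (\<Sum>C\<in>{C \<in> \<C>. w C < 2 * R}. (2 * R) powr p * (b C + h C) + (\<Sum>i\<in>Lt. q i C * W i powr p))"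
    by (intro sum_mono small) auto
  also have "\<dots> \<le> (\<Sum>C\<in>\<C>. (2 * R) powr p * (b C + h C) + (\<Sum>i\<in>Lt. q i C * W i powr p))"
    using fin b0 by (intro sum_mono2 add_nonneg_nonneg mult_nonneg_nonneg sum_nonneg) auto
  also have "\<dots> = (2 * R) powr p * ((\<Sum>C\<in>\<C>. b C) + real (\<Sum>C\<in>\<C>. h C))
      + (\<Sum>C\<in>\<C>. \<Sum>i\<in>Lt. q i C * W i powr p)"
    by (simp only: sum.distrib sum_distrib_left[symmetric] of_nat_sum of_nat_add)
  also have "(\<Sum>C\<in>\<C>. \<Sum>i\<in>Lt. q i C * W i powr p) = (\<Sum>i\<in>Lt. real (\<Sum>C\<in>\<C>. q i C) * W i powr p)"
    by (subst sum.swap) (simp add: sum_distrib_right)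
  \<comment> \<open>After the exchange of sums, each light tree is charged at most once, since it
    has at most one piece in all components together.\<close>
  also have "\<dots> \<le> (\<Sum>i\<in>Lt. 1 * W i powr p)"
    using light_q by (intro sum_mono mult_right_mono) (auto simp del: of_nat_sum)
  finally have small_sum: "(\<Sum>C\<in>{C \<in> \<C>. w C < 2 * R}. w C powr p)
      \<le> (2 * R) powr p * ((\<Sum>C\<in>\<C>. b C) + real (\<Sum>C\<in>\<C>. h C)) + (\<Sum>i\<in>Lt. W i powr p)"
    by simp
  \<comment> \<open>The small components are given the factor \<open>(4 * R) powr (p - 1)\<close> of
    the large ones, so that both are bounded by the linear estimates.\<close>
  have "(2 * R) powr p \<le> (4 * R) powr (p - 1) * (2 * R)"
    using R p by (intro powr_le_mult) auto
  then have "(2 * R) powr p * ((\<Sum>C\<in>\<C>. b C) + real (\<Sum>C\<in>\<C>. h C))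
      \<le> (4 * R) powr (p - 1) * (2 * R) * ((\<Sum>C\<in>\<C>. b C) + real (\<Sum>C\<in>\<C>. h C))"
    using b0 by (intro mult_right_mono add_nonneg_nonneg sum_nonneg of_nat_0_le_iff)
  then have "(4 * R) powr (p - 1) * A + (2 * R) powr p * ((\<Sum>C\<in>\<C>. b C) + real (\<Sum>C\<in>\<C>. h C))
      \<le> (4 * R) powr (p - 1) * (A + 2 * R * (\<Sum>C\<in>\<C>. b C) + 2 * (R * real (\<Sum>C\<in>\<C>. h C)))"
    by (simp add: algebra_simps)
  \<comment> \<open>\<open>main\<close> pays \<open>5 * S\<close> for the first two terms and twice
    \<open>heavy_count\<close> pays \<open>10 * S\<close> for the third.\<close>
  also have "\<dots> \<le> (4 * R) powr (p - 1) * (15 * S)"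
  proof (rule mult_left_mono)
    have "0 \<le> R * (\<Sum>C\<in>\<C>. b C)" using R b0 by (intro mult_nonneg_nonneg sum_nonneg) auto
    then show "A + 2 * R * (\<Sum>C\<in>\<C>. b C) + 2 * (R * real (\<Sum>C\<in>\<C>. h C)) \<le> 15 * S"
      using main heavy_count by linarith
  qed simp
  \<comment> \<open>The base 16 is the ratio of \<open>4 * R\<close> to the threshold
    \<open>R / 4\<close>.\<close>
  also have "\<dots> = 15 * 16 powr (p - 1) * (\<Sum>i\<in>Hv. (R / 4) powr (p - 1) * W i)"
  proof -
    have "(4 * R) powr (p - 1) = 16 powr (p - 1) * (R / 4) powr (p - 1)"
      using R by (simp flip: powr_mult)
    then show ?thesis by (simp add: S_def flip: sum_distrib_left)
  qed
  also have "\<dots> \<le> 15 * 16 powr (p - 1) * (\<Sum>i\<in>Hv. W i powr p)"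
    using R p by (intro mult_left_mono sum_mono powr_ge_mult) (auto simp: Hv_def)
  also have "\<dots> \<le> 16 powr p * (\<Sum>i\<in>Hv. W i powr p)"
  proof (rule mult_right_mono)
    have "16 powr p = 16 powr (p - 1) * (16 :: real) powr 1" by (simp only: powr_add[symmetric]) simp
    then show "15 * 16 powr (p - 1) \<le> (16 :: real) powr p" by simp
  qed (auto intro: sum_nonneg)
  finally have "(4 * R) powr (p - 1) * A + (2 * R) powr p * ((\<Sum>C\<in>\<C>. b C) + real (\<Sum>C\<in>\<C>. h C))
      \<le> 16 powr p * (\<Sum>i\<in>Hv. W i powr p)" .
  moreover have "(\<Sum>i\<in>Lt. W i powr p) \<le> 16 powr p * (\<Sum>i\<in>Lt. W i powr p)"
    using p mult_right_mono[of 1 "16 powr p" "\<Sum>i\<in>Lt. W i powr p"]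
    by (simp add: sum_nonneg ge_one_powr_ge_zero)
  ultimately show ?thesis
    using small_sum by (simp add: A_def sum_distrib_left[symmetric] sumI distrib_left)
qed

subsection \<open>Cutting a tree cover at the long edges\<close>

text \<open>The classes given by \<open>Q\<close> are disjoint, and the members of \<open>P\<close>
  in no class only add nonnegative terms. Values in an ordered monoid cover both counts of pieces
  and weights.\<close>

lemma sum_disjoint_classes_le:
  fixes g :: "'b \<Rightarrow> 'c :: ordered_comm_monoid_add"
  assumes "finite P" "finite \<C>" "\<And>D. D \<in> P \<Longrightarrow> 0 \<le> g D"
    and "\<And>C C' D. C \<in> \<C> \<Longrightarrow> C' \<in> \<C> \<Longrightarrow> D \<in> P \<Longrightarrow> Q D C \<Longrightarrow> Q D C' \<Longrightarrow> C = C'"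
  shows "(\<Sum>C\<in>\<C>. \<Sum>D\<in>{D \<in> P. Q D C}. g D) \<le> sum g P"
proof -
  have "(\<Sum>C\<in>\<C>. \<Sum>D\<in>{D \<in> P. Q D C}. g D) = sum g (\<Union>C\<in>\<C>. {D \<in> P. Q D C})"
    using assms(1,2) by (intro sum.UNION_disjoint[symmetric]) (auto dest: assms(4))
  also have "\<dots> \<le> sum g P"
    using assms(1,3) by (intro sum_mono2) auto
  finally show ?thesis .
qed

lemma sum_UNION_le:
  fixes g :: "'b \<Rightarrow> 'c :: ordered_comm_monoid_add"
  assumes "finite I" "\<And>i. i \<in> I \<Longrightarrow> finite (A i)" "\<And>i x. i \<in> I \<Longrightarrow> x \<in> A i \<Longrightarrow> 0 \<le> g x"
  shows "sum g (\<Union>i\<in>I. A i) \<le> (\<Sum>i\<in>I. sum g (A i))"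
  using assms
proof (induction rule: finite_induct)
  case (insert j I)
  have "sum g (A j \<union> (\<Union>i\<in>I. A i)) = sum g (A j) + sum g ((\<Union>i\<in>I. A i) - A j)"
    using insert.prems insert.hyps by (subst sum.union_disjoint[symmetric]) auto
  also have "\<dots> \<le> sum g (A j) + sum g (\<Union>i\<in>I. A i)"
    using insert.prems insert.hyps by (intro add_left_mono sum_mono2) auto
  also have "\<dots> \<le> sum g (A j) + (\<Sum>i\<in>I. sum g (A i))"
    by (rule add_left_mono, rule insert.IH) (blast intro: insert.prems)+
  finally show ?case using insert.hyps by simp
qed simp

section \<open>Short and long edges, and the pieces of a single tree\<close>

lemma edge_length_nonneg:
  assumes "Metric_space V d" "simple_graph G" "e \<in> gedges G"
  shows "0 \<le> edge_length d e"
proof -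
  interpret Metric_space V d by fact
  obtain u v where "e = {u, v}" using assms(2,3) unfolding simple_graph_def by blast
  then show ?thesis using edge_length_pair[of d u v] commute by simp
qed

lemma weight_nonneg:
  assumes "Metric_space V d" "simple_graph G"
  shows "0 \<le> weight d G"
  unfolding weight_def by (intro sum_nonneg edge_length_nonneg[OF assms])

lemma simple_threshold_graph: "finite V \<Longrightarrow> simple_graph (threshold_graph V d R)"
  unfolding simple_graph_def threshold_graph_def by auto

lemma mem_gedges_threshold_graph:
  assumes "Metric_space V d" "e \<in> gedges (complete_graph V)"
  shows "e \<in> gedges (threshold_graph V d R) \<longleftrightarrow> edge_length d e \<le> R"
proof -
  interpret Metric_space V d by fact
  obtain u v where e: "e = {u, v}" "u \<in> V" "v \<in> V" "u \<noteq> v"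
    using assms(2) by (auto simp: complete_graph_def)
  have "edge_length d {x, y} = d x y" for x y using edge_length_pair commute by metis
  then show ?thesis using e by (auto simp: threshold_graph_def) metis
qed

definition short_graph :: "('a \<Rightarrow> 'a \<Rightarrow> real) \<Rightarrow> real \<Rightarrow> 'a ugraph \<Rightarrow> 'a ugraph" where
  "short_graph d R H = \<lparr>gverts = gverts H, gedges = {e \<in> gedges H. edge_length d e \<le> R}\<rparr>"

definition long_edges :: "('a \<Rightarrow> 'a \<Rightarrow> real) \<Rightarrow> real \<Rightarrow> 'a ugraph \<Rightarrow> 'a set set" where
  "long_edges d R H = {e \<in> gedges H. R < edge_length d e}"

lemma simple_short_graph: "simple_graph H \<Longrightarrow> simple_graph (short_graph d R H)"
  by (simp add: simple_graph_def short_graph_def)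

text \<open>Putting the long edges back restores \<open>H\<close>, which has a single
  component.\<close>

lemma card_pieces_le:
  assumes "simple_graph H" "graph_connected H"
  shows "card (graph_components (short_graph d R H)) \<le> card (long_edges d R H) + 1"
proof -
  have "finite (gverts H)" "finite (long_edges d R H)" "\<forall>e\<in>long_edges d R H. \<exists>a b. e = {a, b}"
    using assms(1) finite_gedges[OF assms(1)] unfolding long_edges_def
    by (auto simp: simple_graph_def) blast
  then have "card (graph_components (short_graph d R H))
      \<le> card (graph_components \<lparr>gverts = gverts H,
          gedges = {e \<in> gedges H. edge_length d e \<le> R} \<union> long_edges d R H\<rparr>)
        + card (long_edges d R H)"
    unfolding short_graph_def by (rule card_components_le_removed_edges)
  also have "\<lparr>gverts = gverts H, gedges = {e \<in> gedges H. edge_length d e \<le> R} \<union> long_edges d R H\<rparr> = H"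
    by (cases H) (auto simp: long_edges_def)
  finally show ?thesis using graph_components_connected[OF assms(2)] by simp
qed

lemma sum_weight_components_le:
  assumes "Metric_space V d" "simple_graph G"
  shows "(\<Sum>D\<in>graph_components G. weight d (induced G D)) \<le> weight d G"
proof -
  have "(\<Sum>D\<in>graph_components G. \<Sum>e\<in>{e \<in> gedges G. e \<subseteq> D}. edge_length d e)
      \<le> sum (edge_length d) (gedges G)"
  proof (rule sum_disjoint_classes_le)
    show "finite (gedges G)" using assms(2) by (rule finite_gedges)
    show "finite (graph_components G)"
      using assms(2) by (intro finite_graph_components) (simp add: simple_graph_def)
    fix D D' e assume D: "D \<in> graph_components G" "D' \<in> graph_components G" "e \<in> gedges G"
      "e \<subseteq> D" "e \<subseteq> D'"
    then obtain u where "u \<in> e" using assms(2) unfolding simple_graph_def by blast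
    with D show "D = D'" using component_eqI[of D G D' u u] by auto
  qed (use edge_length_nonneg[OF assms] in auto)
  then show ?thesis by (simp add: weight_def induced_def)
qed

lemma weight_short_long_le:
  fixes R :: real
  assumes "simple_graph H"
  shows "weight d (short_graph d R H) + card (long_edges d R H) * R \<le> weight d H"
proof -
  have fin: "finite (gedges H)" by (rule finite_gedges[OF assms])
  have "card (long_edges d R H) * R = (\<Sum>e\<in>long_edges d R H. R)" by simp
  also have "\<dots> \<le> (\<Sum>e\<in>long_edges d R H. edge_length d e)"
    by (rule sum_mono) (simp add: long_edges_def)
  finally have "weight d (short_graph d R H) + card (long_edges d R H) * R
      \<le> sum (edge_length d) {e \<in> gedges H. edge_length d e \<le> R}
        + (\<Sum>e\<in>long_edges d R H. edge_length d e)"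
    by (simp add: weight_def short_graph_def)
  also have "\<dots> = sum (edge_length d) ({e \<in> gedges H. edge_length d e \<le> R} \<union> long_edges d R H)"
    using fin by (intro sum.union_disjoint[symmetric]) (auto simp: long_edges_def)
  also have "{e \<in> gedges H. edge_length d e \<le> R} \<union> long_edges d R H = gedges H"
    by (auto simp: long_edges_def)
  finally show ?thesis by (simp add: weight_def)
qed

text \<open>For a subgraph of the complete graph and a component \<open>C\<close> of the threshold
  graph, inclusion in \<open>C\<close> is the same as meeting \<open>C\<close>, by
  \<open>piece_subset_component\<close>.\<close>

definition pieces_in :: "('a \<Rightarrow> 'a \<Rightarrow> real) \<Rightarrow> real \<Rightarrow> 'a ugraph \<Rightarrow> 'a set \<Rightarrow> 'a set set" where
  "pieces_in d R H C = {D \<in> graph_components (short_graph d R H). D \<subseteq> C}"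

definition pieces_weight :: "('a \<Rightarrow> 'a \<Rightarrow> real) \<Rightarrow> real \<Rightarrow> 'a ugraph \<Rightarrow> 'a set \<Rightarrow> real" where
  "pieces_weight d R H C = (\<Sum>D\<in>pieces_in d R H C. weight d (induced (short_graph d R H) D))"

lemma finite_pieces: "simple_graph H \<Longrightarrow> finite (graph_components (short_graph d R H))"
  by (intro finite_graph_components) (simp add: simple_graph_def short_graph_def)

lemma finite_pieces_in: "simple_graph H \<Longrightarrow> finite (pieces_in d R H C)"
  by (simp add: pieces_in_def finite_pieces)

lemma weight_piece_nonneg:
  assumes "Metric_space V d" "simple_graph H" "D \<in> graph_components (short_graph d R H)"
  shows "0 \<le> weight d (induced (short_graph d R H) D)"
  by (intro weight_nonneg[OF assms(1)] simple_graph_induced simple_short_graph assms(2)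
      component_subset assms(3))

lemma pieces_in_unique:
  assumes "C \<in> graph_components G" "C' \<in> graph_components G"
    "D \<in> graph_components S" "D \<subseteq> C" "D \<subseteq> C'"
  shows "C = C'"
proof -
  obtain x where "x \<in> D" using component_nonempty[OF assms(3)] by auto
  then show ?thesis using component_eqI[OF assms(1,2), of x x] assms(4,5) by auto
qed

lemma sum_card_pieces_in_le:
  assumes "simple_graph H" "graph_connected H" "finite (gverts G)"
  shows "(\<Sum>C\<in>graph_components G. card (pieces_in d R H C)) \<le> card (long_edges d R H) + 1"
proof -
  have "(\<Sum>C\<in>graph_components G. \<Sum>D\<in>{D \<in> graph_components (short_graph d R H). D \<subseteq> C}. 1)
      \<le> (\<Sum>D\<in>graph_components (short_graph d R H). 1 :: nat)"
    by (rule sum_disjoint_classes_le)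
      (auto intro: finite_pieces finite_graph_components assms dest: pieces_in_unique)
  then show ?thesis using card_pieces_le[OF assms(1,2), of d R] by (simp add: pieces_in_def)
qed

lemma sum_pieces_weight_le:
  fixes R :: real
  assumes "Metric_space V d" "simple_graph H" "finite (gverts G)"
  shows "(\<Sum>C\<in>graph_components G. pieces_weight d R H C) + card (long_edges d R H) * R \<le> weight d H"
proof -
  have "(\<Sum>C\<in>graph_components G. pieces_weight d R H C)
      \<le> (\<Sum>D\<in>graph_components (short_graph d R H). weight d (induced (short_graph d R H) D))"
    unfolding pieces_weight_def pieces_in_def
    by (rule sum_disjoint_classes_le)
      (auto intro: finite_pieces finite_graph_components weight_piece_nonneg assms dest: pieces_in_unique)
  also have "\<dots> \<le> weight d (short_graph d R H)"
    by (intro sum_weight_components_le[OF assms(1)] simple_short_graph assms(2))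
  finally show ?thesis using weight_short_long_le[OF assms(2), of d R] by linarith
qed

text \<open>The short edges of \<open>H\<close> are edges of the threshold graph, so a walk inside a
  piece never leaves the component in which it starts.\<close>

lemma piece_subset_component:
  assumes "Metric_space V d" "subgraph H (complete_graph V)"
    and C: "C \<in> graph_components (threshold_graph V d R)"
    and D: "D \<in> graph_components (short_graph d R H)" and v: "v \<in> C" "v \<in> D"
  shows "D \<subseteq> C"
proof
  fix x assume x: "x \<in> D"
  have "gedges (short_graph d R H) \<subseteq> gedges (threshold_graph V d R)"
    using mem_gedges_threshold_graph[OF assms(1)] assms(2)
    by (auto simp: short_graph_def subgraph_def)
  with component_reachable[OF D v(2) x] have "reachable (threshold_graph V d R) v x"
    by (rule reachable_mono)
  moreover have "x \<in> gverts (threshold_graph V d R)"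
    using component_subset[OF D] x assms(2)
    by (auto simp: short_graph_def subgraph_def complete_graph_def threshold_graph_def)
  ultimately show "x \<in> C" using component_closed[OF C v(1)] by simp
qed

lemma subgraph_piece:
  assumes "Metric_space V d" "finite V" "subgraph H (complete_graph V)"
    and C: "C \<in> graph_components (threshold_graph V d R)"
    and D: "D \<in> pieces_in d R H C"
  shows "subgraph (induced (short_graph d R H) D) (induced (threshold_graph V d R) C)"
proof -
  have "simple_graph H" using assms(3) by (simp add: subgraph_def)
  then have "simple_graph (induced (short_graph d R H) D)"
    using D by (intro simple_graph_induced simple_short_graph component_subset) (auto simp: pieces_in_def)
  moreover have "simple_graph (induced (threshold_graph V d R) C)"
    by (intro simple_graph_induced simple_threshold_graph component_subset assms(2) C)
  moreover have "gedges (short_graph d R H) \<subseteq> gedges (threshold_graph V d R)"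
    using mem_gedges_threshold_graph[OF assms(1)] assms(3)
    by (auto simp: short_graph_def subgraph_def)
  ultimately show ?thesis using D by (auto simp: subgraph_def induced_def pieces_in_def)
qed

section \<open>A competing cover against the minimum spanning trees\<close>

context
  fixes V :: "'a set" and d :: "'a \<Rightarrow> 'a \<Rightarrow> real" and R :: real and k :: nat and T :: "nat \<Rightarrow> 'a ugraph"
  assumes V: "Metric_space V d" "finite V" and R: "R > 0" and cover: "tree_cover V k T"
begin

lemma piece_of_cover_exists:
  assumes C: "C \<in> graph_components (threshold_graph V d R)" and v: "v \<in> C"
  shows "\<exists>i\<in>{1..k}. \<exists>D\<in>pieces_in d R (T i) C. v \<in> D"
proof -
  have "v \<in> V" using component_subset[OF C] v by (auto simp: threshold_graph_def)
  then obtain i where i: "i \<in> {1..k}" "v \<in> gverts (T i)"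
    using cover unfolding tree_cover_def by blast
  then have "v \<in> gverts (short_graph d R (T i))" by (simp add: short_graph_def)
  then obtain D where D: "D \<in> graph_components (short_graph d R (T i))" "v \<in> D"
    using component_exists by metis
  moreover have "subgraph (T i) (complete_graph V)" using cover i by (simp add: tree_cover_def)
  ultimately have "D \<subseteq> C" using piece_subset_component[OF V(1) _ C D(1) v D(2)] by simp
  with D i show ?thesis by (auto simp: pieces_in_def)
qed

lemma min_spanning_tree_le_pieces:
  assumes C: "C \<in> graph_components (threshold_graph V d R)"
    and M: "min_spanning_tree d M (induced (threshold_graph V d R) C)"
  shows "weight d M \<le> (\<Sum>i=1..k. pieces_weight d R (T i) C)
    + (real (\<Sum>i=1..k. card (pieces_in d R (T i) C)) - 1) * R"
proof -
  let ?G = "induced (threshold_graph V d R) C"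
  \<comment> \<open>Pieces are indexed by pairs, because different trees may have pieces on the same
    vertex set and each of these is counted.\<close>
  define J where "J = (SIGMA i:{1..k}. pieces_in d R (T i) C)"
  define H where "H = (\<lambda>(i, D). induced (short_graph d R (T i)) D)"
  have sub: "subgraph (T i) (complete_graph V)" if "i \<in> {1..k}" for i
    using cover that by (simp add: tree_cover_def)
  then have simp: "simple_graph (T i)" if "i \<in> {1..k}" for i
    using that by (simp add: subgraph_def)
  have fin: "finite (pieces_in d R (T i) C)" if "i \<in> {1..k}" for i
    using simp[OF that] by (rule finite_pieces_in)
  have simpG: "simple_graph ?G"
    by (intro simple_graph_induced simple_threshold_graph component_subset V(2) C)
  have len0: "0 \<le> edge_length d e" if "e \<in> gedges ?G" for e
    using edge_length_nonneg[OF V(1) simpG that] .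
  have "\<exists>K. subgraph K ?G \<and> graph_connected K \<and> gverts K = gverts ?G
      \<and> weight d K \<le> (\<Sum>j\<in>J. weight d (H j)) + (real (card J) - 1) * R"
  proof (rule connect_pieces[OF simpG])
    show "graph_connected ?G"
      by (rule component_connected[OF simple_threshold_graph[OF V(2)] C])
    show "0 \<le> edge_length d e \<and> edge_length d e \<le> R" if "e \<in> gedges ?G" for e
    proof -
      have "e \<in> gedges (threshold_graph V d R)" using that by (simp add: induced_def)
      moreover from this have "e \<in> gedges (complete_graph V)"
        by (auto simp: threshold_graph_def complete_graph_def)
      ultimately show ?thesis using mem_gedges_threshold_graph[OF V(1)] len0[OF that] by blast
    qed
    show "0 \<le> R" using R by simp
    show "finite J" unfolding J_def using fin by (intro finite_SigmaI) auto
    obtain v where "v \<in> C" using component_nonempty[OF C] by auto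
    then show "J \<noteq> {}" using piece_of_cover_exists[OF C] unfolding J_def by blast
    show "subgraph (H j) ?G \<and> graph_connected (H j)" if "j \<in> J" for j
    proof -
      obtain i D where j: "j = (i, D)" "i \<in> {1..k}" "D \<in> pieces_in d R (T i) C"
        using \<open>j \<in> J\<close> unfolding J_def by blast
      then have "graph_connected (induced (short_graph d R (T i)) D)"
        using simp by (intro component_connected simple_short_graph) (auto simp: pieces_in_def)
      then show ?thesis
        using subgraph_piece[OF V sub[OF j(2)] C j(3)] by (simp add: H_def j(1))
    qed
    show "gverts ?G \<subseteq> (\<Union>j\<in>J. gverts (H j))"
    proof
      fix v assume "v \<in> gverts ?G"
      then have "v \<in> C" by (simp add: induced_def)
      then obtain i D where "i \<in> {1..k}" "D \<in> pieces_in d R (T i) C" "v \<in> D"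
        using piece_of_cover_exists[OF C] by blast
      then have "(i, D) \<in> J" "v \<in> gverts (H (i, D))" by (auto simp: J_def H_def induced_def)
      then show "v \<in> (\<Union>j\<in>J. gverts (H j))" by blast
    qed
  qed
  then obtain K where K: "subgraph K ?G" "graph_connected K" "gverts K = gverts ?G"
    "weight d K \<le> (\<Sum>j\<in>J. weight d (H j)) + (real (card J) - 1) * R" by blast
  have "weight d M \<le> weight d K"
    by (rule min_spanning_tree_le_connected[OF M K(1-3) len0])
  also note K(4)
  also have "(\<Sum>j\<in>J. weight d (H j)) = (\<Sum>i=1..k. pieces_weight d R (T i) C)"
    unfolding J_def H_def pieces_weight_def
    using fin by (simp add: sum.Sigma case_prod_beta)
  also have "card J = (\<Sum>i=1..k. card (pieces_in d R (T i) C))"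
    unfolding J_def using fin by (intro card_SigmaI) auto
  finally show ?thesis .
qed

lemma tree_cover_lower_bound:
  fixes M :: "'a set \<Rightarrow> 'a ugraph" and p :: real
  defines "\<C> \<equiv> graph_components (threshold_graph V d R)"
  assumes M: "\<And>C. C \<in> \<C> \<Longrightarrow> min_spanning_tree d (M C) (induced (threshold_graph V d R) C)"
    and k: "(\<Sum>C\<in>\<C>. \<lfloor>(weight d (M C) + 2 * R) / (2 * R)\<rfloor>) = int k"
    and p: "p \<ge> 1"
  shows "(\<Sum>C\<in>{C \<in> \<C>. weight d (M C) \<ge> 2 * R}. (4 * R) powr (p - 1) * weight d (M C))
      + (\<Sum>C\<in>{C \<in> \<C>. weight d (M C) < 2 * R}. weight d (M C) powr p)
      \<le> 16 powr p * (\<Sum>i=1..k. weight d (T i) powr p)"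
proof (rule piece_counting_bound[where q = "\<lambda>i C. card (pieces_in d R (T i) C)"
      and s = "\<lambda>i C. pieces_weight d R (T i) C" and n = "\<lambda>i. card (long_edges d R (T i))"])
  have finV: "finite (gverts (threshold_graph V d R))" using V by (simp add: threshold_graph_def)
  have T: "simple_graph (T i)" "graph_connected (T i)" if "i \<in> {1..k}" for i
    using cover that by (auto simp: tree_cover_def is_tree_def)
  show "finite \<C>" unfolding \<C>_def using finV by (rule finite_graph_components)
  show "0 \<le> pieces_weight d R (T i) C" if "i \<in> {1..k}" for i C
    unfolding pieces_weight_def pieces_in_def using V T[OF that]
    by (auto intro!: sum_nonneg weight_piece_nonneg)
  show "pieces_weight d R (T i) C = 0" if "i \<in> {1..k}" "card (pieces_in d R (T i) C) = 0" for i C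
    using that finite_pieces_in[OF T(1)[OF that(1)]] by (simp add: pieces_weight_def)
  show "(\<Sum>C\<in>\<C>. card (pieces_in d R (T i) C)) \<le> card (long_edges d R (T i)) + 1"
    if "i \<in> {1..k}" for i
    unfolding \<C>_def by (rule sum_card_pieces_in_le[OF T[OF that] finV])
  show "(\<Sum>C\<in>\<C>. pieces_weight d R (T i) C) + card (long_edges d R (T i)) * R \<le> weight d (T i)"
    if "i \<in> {1..k}" for i
    unfolding \<C>_def by (rule sum_pieces_weight_le[OF V(1) T(1)[OF that] finV])
  show "0 \<le> weight d (M C)" if "C \<in> \<C>" for C
    using M[OF that] by (intro weight_nonneg[OF V(1)])
      (simp add: min_spanning_tree_def spanning_tree_def subgraph_def)
  show "weight d (M C) \<le> (\<Sum>i=1..k. pieces_weight d R (T i) C)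
      + (real (\<Sum>i=1..k. card (pieces_in d R (T i) C)) - 1) * R" if "C \<in> \<C>" for C
    using min_spanning_tree_le_pieces M that unfolding \<C>_def by blast
  show "1 \<le> (\<Sum>i=1..k. card (pieces_in d R (T i) C))" if "C \<in> \<C>" for C
  proof -
    have C: "C \<in> graph_components (threshold_graph V d R)" using that by (simp add: \<C>_def)
    then obtain v where "v \<in> C" using component_nonempty by blast
    then obtain i where i: "i \<in> {1..k}" "pieces_in d R (T i) C \<noteq> {}"
      using piece_of_cover_exists[OF C] by blast
    then have "1 \<le> card (pieces_in d R (T i) C)"
      using finite_pieces_in[OF T(1)[OF i(1)]] by (simp add: Suc_le_eq card_gt_0_iff)
    also have "\<dots> \<le> (\<Sum>i=1..k. card (pieces_in d R (T i) C))"
      using i(1) by (intro member_le_sum) auto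
    finally show ?thesis .
  qed
qed (use R p k in auto)

end

section \<open>Trees made from large components, and the final estimate\<close>

lemma tree_decomposition_sum_weight:
  assumes "tree_decomposition d R T F" "finite F"
  shows "(\<Sum>S\<in>F. weight d S) = weight d T"
proof -
  have "simple_graph S" if "S \<in> F" for S
    using assms(1) that by (auto simp: tree_decomposition_def subgraph_def)
  then have "sum (edge_length d) (\<Union>S\<in>F. gedges S) = (\<Sum>S\<in>F. weight d S)"
    unfolding weight_def using assms finite_gedges
    by (intro sum.UNION_disjoint) (auto simp: tree_decomposition_def)
  then show ?thesis using assms(1) by (simp add: weight_def tree_decomposition_def)
qed

lemma tree_decomposition_sum_powr_le:
  assumes "Metric_space V d" "tree_decomposition d R T F" "finite F" "p \<ge> 1"
  shows "(\<Sum>S\<in>F. weight d S powr p) \<le> (4 * R) powr (p - 1) * weight d T"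
proof -
  have "(\<Sum>S\<in>F. weight d S powr p) \<le> (\<Sum>S\<in>F. (4 * R) powr (p - 1) * weight d S)"
  proof (intro sum_mono powr_le_mult)
    fix S assume "S \<in> F"
    then have "simple_graph S" "weight d S \<le> 4 * R"
      using assms(2) by (auto simp: tree_decomposition_def subgraph_def)
    then show "0 \<le> weight d S" "weight d S \<le> 4 * R" using weight_nonneg[OF assms(1)] by auto
  qed (rule assms(4))
  then show ?thesis
    using tree_decomposition_sum_weight[OF assms(2,3)] by (simp flip: sum_distrib_left)
qed

theorem theorem4:
  fixes V :: "'a set" and d :: "'a \<Rightarrow> 'a \<Rightarrow> real" and k :: nat and R p :: real
    and TC :: "'a set \<Rightarrow> 'a ugraph"
    and F :: "'a set \<Rightarrow> 'a ugraph set"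
    and T That :: "nat \<Rightarrow> 'a ugraph"
  defines "\<C> \<equiv> graph_components (threshold_graph V d R)"
  assumes "Metric_space V d" and "finite V" and "k > 0" and "R > 0"
    and "\<forall>C\<in>\<C>. min_spanning_tree d (TC C) (induced (threshold_graph V d R) C)"
    and "(\<Sum>C\<in>\<C>. \<lfloor>(weight d (TC C) + 2 * R) / (2 * R)\<rfloor>) = int k"
    and "\<forall>C\<in>\<C>. weight d (TC C) \<ge> 2 * R \<longrightarrow> tree_decomposition d R (TC C) (F C)"
    and "bij_betw T {1..k}
           ({TC C | C. C \<in> \<C> \<and> weight d (TC C) < 2 * R} \<union>
            (\<Union>C\<in>{C \<in> \<C>. weight d (TC C) \<ge> 2 * R}. F C))"
    and "p \<ge> 1"
    and "tree_cover V k That"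
  shows "(\<Sum>i=1..k. weight d (T i) powr p) powr (1 / p)
           \<le> 24 * (\<Sum>i=1..k. weight d (That i) powr p) powr (1 / p)"
proof -
  define Sm where "Sm = {C \<in> \<C>. weight d (TC C) < 2 * R}"
  define La where "La = {C \<in> \<C>. weight d (TC C) \<ge> 2 * R}"
  have "finite \<C>"
    unfolding \<C>_def using assms(3) by (intro finite_graph_components) (simp add: threshold_graph_def)
  then have fin: "finite Sm" "finite La" by (auto simp: Sm_def La_def)
  have bij: "bij_betw T {1..k} (TC ` Sm \<union> (\<Union>C\<in>La. F C))"
  proof -
    have "TC ` Sm = {TC C | C. C \<in> \<C> \<and> weight d (TC C) < 2 * R}" by (auto simp: Sm_def)
    then show ?thesis using assms(9) by (simp add: La_def)
  qed
  then have "finite (TC ` Sm \<union> (\<Union>C\<in>La. F C))" using bij_betw_finite by blast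
  \<comment> \<open>Finiteness of each family comes from the bijection with \<open>{1..k}\<close>,
    as a decomposition is not finite by definition.\<close>
  then have finF: "finite (F C)" if "C \<in> La" for C
    using that by (meson UN_upper finite_Un finite_subset)
  have "(\<Sum>i=1..k. weight d (T i) powr p) = (\<Sum>S\<in>TC ` Sm \<union> (\<Union>C\<in>La. F C). weight d S powr p)"
    using bij by (rule sum.reindex_bij_betw)
  also have "\<dots> \<le> (\<Sum>S\<in>TC ` Sm. weight d S powr p) + (\<Sum>S\<in>(\<Union>C\<in>La. F C). weight d S powr p)"
    using fin finF by (subst sum_Un) (auto intro!: sum_nonneg)
  \<comment> \<open>Counting over components instead of over the set of trees can only repeat
    nonnegative terms.\<close>
  also have "\<dots> \<le> (\<Sum>C\<in>Sm. weight d (TC C) powr p) + (\<Sum>C\<in>La. \<Sum>S\<in>F C. weight d S powr p)"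
    using fin finF sum_image_le[of Sm "\<lambda>S. weight d S powr p" TC]
    by (intro add_mono sum_UNION_le) (auto simp: o_def)
  also have "(\<Sum>C\<in>La. \<Sum>S\<in>F C. weight d S powr p) \<le> (\<Sum>C\<in>La. (4 * R) powr (p - 1) * weight d (TC C))"
    using assms(2,8,10) finF by (intro sum_mono tree_decomposition_sum_powr_le) (auto simp: La_def)
  also have "(\<Sum>C\<in>Sm. weight d (TC C) powr p) + (\<Sum>C\<in>La. (4 * R) powr (p - 1) * weight d (TC C))
      \<le> 16 powr p * (\<Sum>i=1..k. weight d (That i) powr p)"
    using tree_cover_lower_bound[OF assms(2,3,5,11), of TC p] assms(6,7,10)
    by (simp add: Sm_def La_def \<C>_def add.commute)
  finally have "(\<Sum>i=1..k. weight d (T i) powr p) powr (1 / p)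
      \<le> (16 powr p * (\<Sum>i=1..k. weight d (That i) powr p)) powr (1 / p)"
    using assms(10) by (intro powr_mono2) (auto intro!: sum_nonneg)
  also have "\<dots> = 16 * (\<Sum>i=1..k. weight d (That i) powr p) powr (1 / p)"
    using assms(10) by (simp add: powr_mult powr_powr sum_nonneg)
  also have "\<dots> \<le> 24 * (\<Sum>i=1..k. weight d (That i) powr p) powr (1 / p)"
    by (intro mult_right_mono) auto
  finally show ?thesis .
qed

end
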